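(* For every $n\ge1$, there exists an $n\times n$ HKZ-reduced basis $B$ such that $\mathrm{dist}(\mathbb{Z}^n,\mathcal{L}(B))\le n^{O(\log n)}$, but $\kappa(B)\ge\Omega(1.5^n)$.
   Context: $\mathcal{L}(B)$ is the lattice generated by the columns of $B$. For invertible $T$, $\kappa(T)=\|T\|\,\|T^{-1}\|$ (Euclidean operator norm), and $\mathrm{dist}(\mathcal{L}_1,\mathcal{L}_2)=\min\{\kappa(T): T\text{ linear},\ T(\mathcal{L}_1)=\mathcal{L}_2\}$. For a basis $B=[b_1,\dots,b_m]$, let $\pi_i$ be orthogonal projection onto $\{b_1,\dots,b_{i-1}\}^\perp$, $\tilde b_i=\pi_i(b_i)$, $\mu_{ij}=\langle b_i,\tilde b_j\rangle/\langle\tilde b_j,\tilde b_j\rangle$. A basis $B$ of $\mathcal{L}$ is HKZ reduced (recursively) if $|\mu_{ij}|\le1/2$ for all $j<i$, $\|b_1\|=\lambda_1(\mathcal{L})$ (the length of a shortest nonzero vector), and, if $m>1$, $[\pi_2(b_2),\dots,\pi_2(b_m)]$ is an HKZ-reduced basis of the lattice $\pi_2(\mathcal{L})$ (viewed as full-rank in its span). The asymptotic notation hides universal constants. *)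

theory Defs
  imports
    Complex_Main
    "Jordan_Normal_Form.VS_Connect"
    "Jordan_Normal_Form.Gauss_Jordan_Elimination"
begin

text \<open>
  The dimension is quantified inside the final statement, so vectors and matrices are those of
  \<^theory>\<open>Jordan_Normal_Form.Matrix\<close>, whose dimensions are terms. Linear maps of $R^n$ are
  identified with $n \times n$ matrices. A basis \<open>b\<^sub>1, \<dots>, b\<^sub>m\<close> is a list of vectors
  indexed from \<open>0\<close>.
\<close>

definition eucl_norm :: "real vec \<Rightarrow> real" where
  "eucl_norm v = sqrt (v \<bullet> v)"

definition op_norm :: "real mat \<Rightarrow> real" where
  "op_norm T = Sup {eucl_norm (T *\<^sub>v x) | x. x \<in> carrier_vec (dim_col T) \<and> eucl_norm x = 1}"

text \<open>Meaningful for invertible matrices only, where \<open>mat_inverse\<close> is not \<open>None\<close>.\<close>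

definition cond_number :: "real mat \<Rightarrow> real" where
  "cond_number T = op_norm T * op_norm (the (mat_inverse T))"

definition lattice_gen :: "real mat \<Rightarrow> real vec set" where
  "lattice_gen B = vec_module.lattice_of (dim_row B) (cols B)"

definition int_lattice :: "nat \<Rightarrow> real vec set" where
  "int_lattice n = {x \<in> carrier_vec n. \<forall>i<n. x $ i \<in> \<int>}"

text \<open>
  For full-rank lattices the infimum is a minimum: the admissible matrices are
  $B_2 U B_1^{-1}$ with $U$ unimodular, so all have the same $|\det T|$ and only finitely many of
  them have condition number below a given bound.
\<close>

definition lattice_dist :: "nat \<Rightarrow> real vec set \<Rightarrow> real vec set \<Rightarrow> real" where
  "lattice_dist n L1 L2 =
     Inf {cond_number T | T. T \<in> carrier_mat n n \<and> invertible_mat T \<and> (\<lambda>x. T *\<^sub>v x) ` L1 = L2}"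

definition min_length :: "nat \<Rightarrow> real vec set \<Rightarrow> real" where
  "min_length n L = Inf (eucl_norm ` (L - {0\<^sub>v n}))"

abbreviation vspan :: "nat \<Rightarrow> real vec set \<Rightarrow> real vec set" where
  "vspan n \<equiv> LinearCombinations.module.span class_ring (module_vec TYPE(real) n)"

abbreviation vlin_dep :: "nat \<Rightarrow> real vec set \<Rightarrow> bool" where
  "vlin_dep n \<equiv> module.lin_dep class_ring (module_vec TYPE(real) n)"

text \<open>Orthogonal projection onto the orthogonal complement of \<open>S\<close>.\<close>

definition proj_perp :: "nat \<Rightarrow> real vec set \<Rightarrow> real vec \<Rightarrow> real vec" where
  "proj_perp n S v =
     (THE w. w \<in> vec_module.orthogonal_complement n S \<and> v - w \<in> vspan n S)"

definition gs_vec :: "nat \<Rightarrow> real vec list \<Rightarrow> nat \<Rightarrow> real vec" where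
  "gs_vec n bs i = proj_perp n (set (take i bs)) (bs ! i)"

definition gs_coeff :: "nat \<Rightarrow> real vec list \<Rightarrow> nat \<Rightarrow> nat \<Rightarrow> real" where
  "gs_coeff n bs i j = (bs ! i \<bullet> gs_vec n bs j) / (gs_vec n bs j \<bullet> gs_vec n bs j)"

definition lattice_basis :: "nat \<Rightarrow> real vec list \<Rightarrow> real vec set \<Rightarrow> bool" where
  "lattice_basis n bs L \<longleftrightarrow>
     set bs \<subseteq> carrier_vec n \<and> distinct bs \<and> \<not> vlin_dep n (set bs) \<and>
     L = vec_module.lattice_of n bs"

text \<open>
  \<open>hkz_reduced n bs L\<close>: the list \<open>bs\<close> is an HKZ-reduced basis of the lattice \<open>L\<close> in $R^n$, of
  any rank \<open>length bs \<le> n\<close>; so the projected lattice need not be moved to a space of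
  smaller dimension. The equation for the empty list is a convention and is never reached
  from a nonempty one.
\<close>

fun hkz_reduced :: "nat \<Rightarrow> real vec list \<Rightarrow> real vec set \<Rightarrow> bool" where
  "hkz_reduced n [] L \<longleftrightarrow> lattice_basis n [] L"
| "hkz_reduced n (b # bs) L \<longleftrightarrow>
     lattice_basis n (b # bs) L \<and>
     (\<forall>i < length (b # bs). \<forall>j < i. \<bar>gs_coeff n (b # bs) i j\<bar> \<le> 1 / 2) \<and>
     eucl_norm b = min_length n L \<and>
     (bs \<noteq> [] \<longrightarrow> hkz_reduced n (map (proj_perp n {b}) bs) (proj_perp n {b} ` L))"

end

theory Submission
  imports Defs
begin

text \<open>
  The basis is the unit upper triangular matrix with all entries above the diagonal equal to
  \<open>- 1 / 2\<close>. All its Gram--Schmidt vectors are unit vectors, and a lattice vector is at least as long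
  as the Gram--Schmidt vector of its last nonzero coefficient; so the first basis vector is shortest
  in every projected lattice and the basis is HKZ reduced. Its inverse maps the last unit vector to
  a vector with first entry \<open>(1 / 2) (3 / 2)^(n - 2)\<close>.

  A well-conditioned basis of the lattice comes from Seysen's recursion, which applies to every unit
  upper triangular matrix: reduce the two diagonal blocks of half size, then subtract integer
  combinations of the columns of the first block from the remaining columns. Each halving multiplies
  the bound on the entries of the matrix and of its inverse by at most \<open>n\<close>, which gives
  \<open>n^(O(log n))\<close>.
\<close>

section \<open>Norms, condition numbers and integral matrices\<close>

lemma scalar_prod_self_sum: "v \<bullet> v = (\<Sum>i<dim_vec v. (v $ i)\<^sup>2)" for v :: "real vec"
  by (simp add: scalar_prod_def power2_eq_square lessThan_atLeast0)

lemma abs_index_le_eucl_norm: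
  assumes "i < dim_vec v"
  shows "\<bar>v $ i\<bar> \<le> eucl_norm v"
proof -
  have "(v $ i)\<^sup>2 \<le> (\<Sum>j<dim_vec v. (v $ j)\<^sup>2)"
    using assms by (intro member_le_sum) auto
  then show ?thesis
    unfolding eucl_norm_def scalar_prod_self_sum by (intro real_le_rsqrt) simp
qed

lemma eucl_norm_nonneg: "0 \<le> eucl_norm v"
  by (simp add: eucl_norm_def scalar_prod_self_sum sum_nonneg)

lemma eucl_norm_le:
  assumes "\<And>i. i < dim_vec v \<Longrightarrow> \<bar>v $ i\<bar> \<le> K" and "0 \<le> K"
  shows "eucl_norm v \<le> real (dim_vec v) * K"
proof -
  have "(v $ i)\<^sup>2 \<le> K\<^sup>2" if "i < dim_vec v" for i
    using assms(1)[OF that] by (metis abs_ge_zero power2_abs power_mono)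
  then have "(\<Sum>i<dim_vec v. (v $ i)\<^sup>2) \<le> (\<Sum>i<dim_vec v. K\<^sup>2)"
    by (intro sum_mono) auto
  also have "\<dots> = real (dim_vec v) * K\<^sup>2"
    by simp
  also have "\<dots> \<le> (real (dim_vec v))\<^sup>2 * K\<^sup>2"
    by (intro mult_right_mono) (auto simp: power2_eq_square simp flip: of_nat_mult)
  finally show ?thesis
    unfolding eucl_norm_def scalar_prod_self_sum using assms(2)
    by (intro real_le_lsqrt) (auto simp: power_mult_distrib sum_nonneg)
qed

lemma eucl_norm_unit_vec: "i < n \<Longrightarrow> eucl_norm (unit_vec n i) = 1"
  by (simp add: eucl_norm_def)

lemma eucl_norm_smult: "eucl_norm (c \<cdot>\<^sub>v v) = \<bar>c\<bar> * eucl_norm v"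
  by (simp add: eucl_norm_def real_sqrt_mult flip: mult.assoc)

lemma eucl_norm_mult_mat_vec_le:
  assumes T: "T \<in> carrier_mat n m"
    and S: "\<And>i j. i < n \<Longrightarrow> j < m \<Longrightarrow> \<bar>T $$ (i, j)\<bar> \<le> S" "0 \<le> S"
    and x: "x \<in> carrier_vec m" "eucl_norm x = 1"
  shows "eucl_norm (T *\<^sub>v x) \<le> real n * (real m * S)"
proof -
  have "\<bar>(T *\<^sub>v x) $ i\<bar> \<le> real m * S" if i: "i < n" for i
  proof -
    have "\<bar>(T *\<^sub>v x) $ i\<bar> = \<bar>\<Sum>j<m. T $$ (i, j) * x $ j\<bar>"
      using T x i by (simp add: scalar_prod_def lessThan_atLeast0)
    also have "\<dots> \<le> (\<Sum>j<m. \<bar>T $$ (i, j) * x $ j\<bar>)"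
      by (rule sum_abs)
    also have "\<dots> \<le> (\<Sum>j<m. S)"
    proof (intro sum_mono)
      fix j assume "j \<in> {..<m}"
      then have "\<bar>T $$ (i, j)\<bar> * \<bar>x $ j\<bar> \<le> S * 1"
        using S i x abs_index_le_eucl_norm[of j x] by (intro mult_mono) auto
      then show "\<bar>T $$ (i, j) * x $ j\<bar> \<le> S"
        by (simp add: abs_mult)
    qed
    finally show ?thesis by simp
  qed
  then show ?thesis
    using eucl_norm_le[of "T *\<^sub>v x" "real m * S"] T S(2) by auto
qed

text \<open>Entry bounds control the operator norm up to the factor \<open>n * m\<close>; such
  polynomial losses are absorbed by \<open>n^(O(log n))\<close>. The hypothesis \<open>0 < m\<close>
  provides a unit vector, so the \<open>Sup\<close> is taken over a nonempty set.\<close>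

lemma op_norm_le:
  assumes T: "T \<in> carrier_mat n m" and m: "0 < m"
    and S: "\<And>i j. i < n \<Longrightarrow> j < m \<Longrightarrow> \<bar>T $$ (i, j)\<bar> \<le> S" "0 \<le> S"
  shows "op_norm T \<le> real n * (real m * S)"
  unfolding op_norm_def
proof (rule cSup_least)
  show "{eucl_norm (T *\<^sub>v x) |x. x \<in> carrier_vec (dim_col T) \<and> eucl_norm x = 1} \<noteq> {}"
    using T m eucl_norm_unit_vec[of 0 m] by (auto intro!: exI[of _ "unit_vec m 0"])
qed (use eucl_norm_mult_mat_vec_le[OF T S] T in auto)

lemma eucl_norm_le_op_norm:
  assumes T: "T \<in> carrier_mat n m" and x: "x \<in> carrier_vec m" "eucl_norm x = 1"
  shows "eucl_norm (T *\<^sub>v x) \<le> op_norm T"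
  unfolding op_norm_def
proof (rule cSup_upper)
  show "bdd_above {eucl_norm (T *\<^sub>v x) |x. x \<in> carrier_vec (dim_col T) \<and> eucl_norm x = 1}"
  proof -
    \<comment> \<open>The sum of all absolute entries is a common entry bound; it serves only to
      show that the set is bounded, so that its \<open>Sup\<close> is a genuine supremum.\<close>
    define S where "S = (\<Sum>i<n. \<Sum>j<m. \<bar>T $$ (i, j)\<bar>)"
    have "\<bar>T $$ (i, j)\<bar> \<le> S" if "i < n" "j < m" for i j
    proof -
      have "\<bar>T $$ (i, j)\<bar> \<le> (\<Sum>j<m. \<bar>T $$ (i, j)\<bar>)"
        using that by (intro member_le_sum) auto
      also have "\<dots> \<le> S"
        unfolding S_def using that
        by (intro member_le_sum[where f = "\<lambda>i. \<Sum>j<m. \<bar>T $$ (i, j)\<bar>"]) (auto intro: sum_nonneg)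
      finally show ?thesis .
    qed
    moreover have "0 \<le> S"
      by (auto simp: S_def intro!: sum_nonneg)
    ultimately show ?thesis
      using eucl_norm_mult_mat_vec_le[OF T, of S] T by (auto simp: bdd_above_def)
  qed
qed (use T x in auto)

lemma op_norm_nonneg:
  assumes "T \<in> carrier_mat n m" "0 < m"
  shows "0 \<le> op_norm T"
  using eucl_norm_le_op_norm[OF assms(1), of "unit_vec m 0"] assms eucl_norm_unit_vec[of 0 m]
    eucl_norm_nonneg by (meson order_trans unit_vec_carrier)

section \<open>Inverses, condition numbers and the lattice distance\<close>

text \<open>By uniqueness of inverses, the value of \<open>mat_inverse\<close> in
  \<open>cond_number\<close> is any two-sided inverse already at hand.\<close>

lemma mat_inverse_eq:
  fixes T :: "'a :: field mat"
  assumes T: "T \<in> carrier_mat n n" and D: "D \<in> carrier_mat n n" and inv: "T * D = 1\<^sub>m n" "D * T = 1\<^sub>m n"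
  shows "mat_inverse T = Some D"
proof (cases "mat_inverse T")
  case None
  then have "T \<notin> Units (ring_mat TYPE('a) n ())"
    by (rule mat_inverse(1)[OF T])
  then show ?thesis
    using assms by (auto simp: Units_def ring_mat_def)
next
  case (Some D')
  then have D': "T * D' = 1\<^sub>m n" "D' \<in> carrier_mat n n"
    using mat_inverse(2)[OF T Some] by auto
  have "D' = (D * T) * D'"
    using D' inv by simp
  also have "\<dots> = D * (T * D')"
    using D D' T by simp
  finally show ?thesis
    using Some D D' by simp
qed

lemma invertible_matE:
  fixes T :: "'a :: semiring_1 mat"
  assumes T: "T \<in> carrier_mat n n" and "invertible_mat T"
  obtains D where "D \<in> carrier_mat n n" "T * D = 1\<^sub>m n" "D * T = 1\<^sub>m n"
proof -
  obtain D where D: "T * D = 1\<^sub>m n" "D * T = 1\<^sub>m (dim_row D)"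
    using assms by (auto simp: invertible_mat_def inverts_mat_def)
  have "dim_col D = n"
    using arg_cong[OF D(1), of dim_col] by simp
  moreover have "dim_row D = n"
    using arg_cong[OF D(2), of dim_col] T by simp
  ultimately show ?thesis
    using that[of D] D by auto
qed

lemma cond_number_nonneg:
  assumes "T \<in> carrier_mat n n" "invertible_mat T" "0 < n"
  shows "0 \<le> cond_number T"
proof -
  obtain D where "D \<in> carrier_mat n n" "T * D = 1\<^sub>m n" "D * T = 1\<^sub>m n"
    using invertible_matE[OF assms(1,2)] by blast
  then show ?thesis
    using mat_inverse_eq[OF assms(1)] op_norm_nonneg[OF _ assms(3)] assms(1)
    by (simp add: cond_number_def)
qed

text \<open>One admissible \<open>T\<close> bounds the infimum from above; the set is bounded below
  because condition numbers are nonnegative.\<close>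

lemma lattice_dist_le_cond_number:
  assumes "0 < n" "T \<in> carrier_mat n n" "D \<in> carrier_mat n n" "T * D = 1\<^sub>m n" "D * T = 1\<^sub>m n"
    and "(\<lambda>x. T *\<^sub>v x) ` L1 = L2"
  shows "lattice_dist n L1 L2 \<le> cond_number T"
  unfolding lattice_dist_def
proof (rule cInf_lower)
  have "invertible_mat T"
    using assms by (auto simp: invertible_mat_def inverts_mat_def)
  then show "cond_number T \<in> {cond_number T |T. T \<in> carrier_mat n n \<and> invertible_mat T \<and> (\<lambda>x. T *\<^sub>v x) ` L1 = L2}"
    using assms by auto
qed (auto intro!: bdd_belowI[of _ 0] cond_number_nonneg assms(1))

section \<open>Lattices as images of the integer lattice, and integral matrices\<close>

lemma lattice_of_eq:
  assumes "set fs \<subseteq> carrier_vec n"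
  shows "vec_module.lattice_of n fs =
    range (\<lambda>c. vec n (\<lambda>r. \<Sum>i<length fs. real_of_int (c i) * fs ! i $ r))"
proof -
  interpret vec_module "TYPE(real)" n .
  have fs: "fs ! i \<in> carrier_vec n" if "i < length fs" for i
    using assms that by auto
  have "sumlist (map (\<lambda>i. of_int (c i) \<cdot>\<^sub>v fs ! i) [0..<length fs])
     = vec n (\<lambda>r. \<Sum>i<length fs. real_of_int (c i) * fs ! i $ r)" (is "sumlist ?xs = _") for c
  proof
    have d: "\<forall>x\<in>set ?xs. dim_vec x = n"
      using fs by auto
    show "dim_vec (sumlist ?xs) = dim_vec (vec n (\<lambda>r. \<Sum>i<length fs. real_of_int (c i) * fs ! i $ r))"
      using dim_sumlist[OF d] by simp
    fix r assume "r < dim_vec (vec n (\<lambda>r. \<Sum>i<length fs. real_of_int (c i) * fs ! i $ r))"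
    then have r: "r < n" by simp
    have "dim_vec (fs ! i) = n" if "i < length fs" for i
      using fs[OF that] by simp
    then show "sumlist ?xs $ r = vec n (\<lambda>r. \<Sum>i<length fs. real_of_int (c i) * fs ! i $ r) $ r"
      unfolding sumlist_nth[OF d r] using r by (auto simp: lessThan_atLeast0 intro!: sum.cong)
  qed
  then show ?thesis
    unfolding lattice_of_def by simp
qed

text \<open>A lattice point is the matrix applied to its integer coefficient vector; in this form a
  change of basis is a composition of maps.\<close>

lemma lattice_gen_eq_image:
  assumes B: "B \<in> carrier_mat n m"
  shows "lattice_gen B = (\<lambda>x. B *\<^sub>v x) ` int_lattice m"
proof -
  have "lattice_gen B = range (\<lambda>c. B *\<^sub>v vec m (\<lambda>i. real_of_int (c i)))"
    unfolding lattice_gen_def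
    using B cols_dim[of B]
    by (subst lattice_of_eq)
       (auto simp: scalar_prod_def lessThan_atLeast0 mult.commute intro!: image_cong eq_vecI sum.cong)
  also have "\<dots> = (\<lambda>x. B *\<^sub>v x) ` range (\<lambda>c. vec m (\<lambda>i. real_of_int (c i)))"
    by auto
  also have "range (\<lambda>c. vec m (\<lambda>i. real_of_int (c i))) = int_lattice m"
  proof (intro equalityI subsetI)
    fix x assume x: "x \<in> int_lattice m"
    then have "x = vec m (\<lambda>i. real_of_int \<lfloor>x $ i\<rfloor>)"
      by (auto simp: int_lattice_def Ints_def intro!: eq_vecI)
    then show "x \<in> range (\<lambda>c. vec m (\<lambda>i. real_of_int (c i)))"
      by (rule range_eqI[where x = "\<lambda>i. \<lfloor>x $ i\<rfloor>"])
  qed (auto simp: int_lattice_def)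
  finally show ?thesis .
qed

definition integral_mat :: "real mat \<Rightarrow> bool" where
  "integral_mat U \<longleftrightarrow> (\<forall>i < dim_row U. \<forall>j < dim_col U. U $$ (i, j) \<in> \<int>)"

lemma integral_matI:
  assumes "U \<in> carrier_mat n m" "\<And>i j. i < n \<Longrightarrow> j < m \<Longrightarrow> U $$ (i, j) \<in> \<int>"
  shows "integral_mat U"
  using assms by (auto simp: integral_mat_def)

lemma integral_matD:
  "integral_mat U \<Longrightarrow> U \<in> carrier_mat n m \<Longrightarrow> i < n \<Longrightarrow> j < m \<Longrightarrow> U $$ (i, j) \<in> \<int>"
  by (auto simp: integral_mat_def)

lemma integral_mat_mult:
  assumes "U \<in> carrier_mat n m" "V \<in> carrier_mat m l" "integral_mat U" "integral_mat V"
  shows "integral_mat (U * V)"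
proof (rule integral_matI)
  show "U * V \<in> carrier_mat n l"
    using assms by simp
  fix i j assume "i < n" "j < l"
  then show "(U * V) $$ (i, j) \<in> \<int>"
    using assms by (auto simp: scalar_prod_def intro!: Ints_sum Ints_mult intro: integral_matD)
qed

lemma integral_mat_uminus:
  assumes "U \<in> carrier_mat n m" "integral_mat U"
  shows "integral_mat (- U)"
  using assms by (intro integral_matI[of _ n m]) (auto intro: integral_matD)

lemma integral_mat_four_block:
  assumes "A \<in> carrier_mat n1 m1" "B \<in> carrier_mat n1 m2" "C \<in> carrier_mat n2 m1" "D \<in> carrier_mat n2 m2"
    and "integral_mat A" "integral_mat B" "integral_mat C" "integral_mat D"
  shows "integral_mat (four_block_mat A B C D)"
  using assms
  by (intro integral_matI[OF four_block_carrier_mat[of A n1 m1 D n2 m2]]) (auto intro: integral_matD)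

lemma image_int_lattice_subset:
  assumes "U \<in> carrier_mat n m" "integral_mat U"
  shows "(\<lambda>x. U *\<^sub>v x) ` int_lattice m \<subseteq> int_lattice n"
  using assms
  by (auto simp: int_lattice_def scalar_prod_def intro!: Ints_sum Ints_mult integral_matD[of U n m])

text \<open>Surjectivity comes from the integral right inverse, since \<open>V *\<^sub>v x\<close>
  is a preimage of \<open>x\<close>. Hence a change of basis by \<open>U\<close> preserves the
  lattice.\<close>

lemma image_int_lattice_unimodular:
  assumes U: "U \<in> carrier_mat n n" "integral_mat U" and V: "V \<in> carrier_mat n n" "integral_mat V"
    and UV: "U * V = 1\<^sub>m n"
  shows "(\<lambda>x. U *\<^sub>v x) ` int_lattice n = int_lattice n"
proof
  show "(\<lambda>x. U *\<^sub>v x) ` int_lattice n \<subseteq> int_lattice n"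
    by (rule image_int_lattice_subset[OF U])
  show "int_lattice n \<subseteq> (\<lambda>x. U *\<^sub>v x) ` int_lattice n"
  proof
    fix x assume x: "x \<in> int_lattice n"
    then have "x \<in> carrier_vec n"
      by (simp add: int_lattice_def)
    then have "x = U *\<^sub>v (V *\<^sub>v x)"
      using U V UV by (simp flip: assoc_mult_mat_vec)
    moreover have "V *\<^sub>v x \<in> int_lattice n"
      using image_int_lattice_subset[OF V] x by blast
    ultimately show "x \<in> (\<lambda>x. U *\<^sub>v x) ` int_lattice n"
      by blast
  qed
qed

section \<open>Seysen reduction\<close>

definition unit_upper_triangular :: "'a :: zero_neq_one mat \<Rightarrow> bool" where
  "unit_upper_triangular A \<longleftrightarrow> upper_triangular A \<and> (\<forall>i < dim_row A. A $$ (i, i) = 1)"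

text \<open>A bound on the maximum norm, which can be checked block by block and so suits the
  recursion on halves; operator norms enter only at the end.\<close>

definition entries_bounded :: "real \<Rightarrow> real mat \<Rightarrow> bool" where
  "entries_bounded K A \<longleftrightarrow> (\<forall>i < dim_row A. \<forall>j < dim_col A. \<bar>A $$ (i, j)\<bar> \<le> K)"

lemma entries_boundedD:
  "entries_bounded K A \<Longrightarrow> A \<in> carrier_mat n m \<Longrightarrow> i < n \<Longrightarrow> j < m \<Longrightarrow> \<bar>A $$ (i, j)\<bar> \<le> K"
  by (auto simp: entries_bounded_def)

lemma entries_bounded_mono: "entries_bounded K A \<Longrightarrow> K \<le> K' \<Longrightarrow> entries_bounded K' A"
  by (force simp: entries_bounded_def)

lemma entries_bounded_uminus: "entries_bounded K A \<Longrightarrow> entries_bounded K (- A)"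
  by (auto simp: entries_bounded_def)

lemma entries_bounded_mult:
  assumes P: "P \<in> carrier_mat n m" "entries_bounded p P" and Q: "Q \<in> carrier_mat m l" "entries_bounded q Q"
    and nonneg: "0 \<le> p"
  shows "entries_bounded (real m * (p * q)) (P * Q)"
  unfolding entries_bounded_def
proof (intro allI impI)
  fix i j assume "i < dim_row (P * Q)" "j < dim_col (P * Q)"
  then have ij: "i < n" "j < l"
    using P Q by auto
  have "\<bar>(P * Q) $$ (i, j)\<bar> = \<bar>\<Sum>k<m. P $$ (i, k) * Q $$ (k, j)\<bar>"
    using P Q ij by (simp add: scalar_prod_def lessThan_atLeast0)
  also have "\<dots> \<le> (\<Sum>k<m. \<bar>P $$ (i, k) * Q $$ (k, j)\<bar>)"
    by (rule sum_abs)
  also have "\<dots> \<le> (\<Sum>k<m. p * q)"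
    unfolding abs_mult using P Q ij nonneg
    by (intro sum_mono mult_mono) (auto intro: entries_boundedD)
  finally show "\<bar>(P * Q) $$ (i, j)\<bar> \<le> real m * (p * q)"
    by simp
qed

lemma entries_bounded_four_block:
  assumes "A \<in> carrier_mat n1 m1" "B \<in> carrier_mat n1 m2" "C \<in> carrier_mat n2 m1" "D \<in> carrier_mat n2 m2"
    and "entries_bounded K A" "entries_bounded K B" "entries_bounded K C" "entries_bounded K D"
  shows "entries_bounded K (four_block_mat A B C D)"
  using assms by (auto simp: entries_bounded_def)

lemma mult_block_upper_triangular:
  fixes A1 :: "'a :: semiring_1 mat"
  assumes "A1 \<in> carrier_mat m m" "B1 \<in> carrier_mat m l" "D1 \<in> carrier_mat l l"
    and "A2 \<in> carrier_mat m m" "B2 \<in> carrier_mat m l" "D2 \<in> carrier_mat l l"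
  shows "four_block_mat A1 B1 (0\<^sub>m l m) D1 * four_block_mat A2 B2 (0\<^sub>m l m) D2
    = four_block_mat (A1 * A2) (A1 * B2 + B1 * D2) (0\<^sub>m l m) (D1 * D2)"
  using assms by (subst mult_four_block_mat[of _ m m _ l _ l]) auto

text \<open>\<open>M\<close> stays fixed while \<open>n\<close> is halved, so both halves satisfy
  the same bound \<open>M ^ k\<close>. \<open>V\<close> witnesses that \<open>U\<close> is
  unimodular, and \<open>D\<close> is the inverse of the reduced basis \<open>A * U\<close>; both
  are built along with \<open>U\<close>.\<close>

lemma seysen_reduction:
  fixes A :: "real mat"
  assumes "A \<in> carrier_mat n n" "unit_upper_triangular A" "n \<le> 2 ^ k" "real n \<le> M" "1 \<le> M"
  shows "\<exists>U V D. U \<in> carrier_mat n n \<and> V \<in> carrier_mat n n \<and> D \<in> carrier_mat n n \<and>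
    integral_mat U \<and> integral_mat V \<and> U * V = 1\<^sub>m n \<and> A * U * D = 1\<^sub>m n \<and> D * (A * U) = 1\<^sub>m n \<and>
    entries_bounded (M ^ k) (A * U) \<and> entries_bounded (M ^ k) D"
  using assms
proof (induction k arbitrary: n A)
  case 0
  \<comment> \<open>Here \<open>n\<close> is at most 1, so only a diagonal entry can occur.\<close>
  have "A = 1\<^sub>m n"
  proof (rule eq_matI)
    fix i j assume "i < dim_row (1\<^sub>m n :: real mat)" "j < dim_col (1\<^sub>m n :: real mat)"
    moreover from this have "i = j"
      using "0.prems" by simp
    ultimately show "A $$ (i, j) = 1\<^sub>m n $$ (i, j)"
      using "0.prems" by (simp add: unit_upper_triangular_def)
  qed (use "0.prems" in auto)
  moreover have "integral_mat (1\<^sub>m n)" "entries_bounded 1 (1\<^sub>m n)"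
    by (auto simp: integral_mat_def entries_bounded_def)
  ultimately show ?case
    by (intro exI[of _ "1\<^sub>m n"]) auto
next
  case (Suc k)
  define m l where "m = n div 2" and "l = n - n div 2"
  have n: "n = m + l" and ml: "m \<le> 2 ^ k" "l \<le> 2 ^ k" "real m \<le> M" "real l \<le> M"
    using Suc.prems unfolding m_def l_def by auto
  define A1 X A2 where "A1 = mat m m (\<lambda>(i, j). A $$ (i, j))"
    and "X = mat m l (\<lambda>(i, j). A $$ (i, j + m))"
    and "A2 = mat l l (\<lambda>(i, j). A $$ (i + m, j + m))"
  have c: "A1 \<in> carrier_mat m m" "X \<in> carrier_mat m l" "A2 \<in> carrier_mat l l"
    by (auto simp: A1_def X_def A2_def)
  have A: "A = four_block_mat A1 X (0\<^sub>m l m) A2"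
    using Suc.prems n
    by (intro eq_matI) (auto simp: A1_def X_def A2_def unit_upper_triangular_def)
  have "unit_upper_triangular A1" "unit_upper_triangular A2"
    using Suc.prems n by (auto simp: A1_def A2_def unit_upper_triangular_def upper_triangular_def)
  with Suc.IH[OF c(1)] Suc.IH[OF c(3)] ml \<open>1 \<le> M\<close> obtain U1 V1 D1 U2 V2 D2 where
    U: "U1 \<in> carrier_mat m m" "U2 \<in> carrier_mat l l" and V: "V1 \<in> carrier_mat m m" "V2 \<in> carrier_mat l l"
    and D: "D1 \<in> carrier_mat m m" "D2 \<in> carrier_mat l l"
    and int: "integral_mat U1" "integral_mat U2" "integral_mat V1" "integral_mat V2"
    and UV: "U1 * V1 = 1\<^sub>m m" "U2 * V2 = 1\<^sub>m l"
    and AUD: "A1 * U1 * D1 = 1\<^sub>m m" "A2 * U2 * D2 = 1\<^sub>m l" "D1 * (A1 * U1) = 1\<^sub>m m" "D2 * (A2 * U2) = 1\<^sub>m l"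
    and bd: "entries_bounded (M ^ k) (A1 * U1)" "entries_bounded (M ^ k) (A2 * U2)"
      "entries_bounded (M ^ k) D1" "entries_bounded (M ^ k) D2"
    by metis
  define T1 T2 where "T1 = A1 * U1" and "T2 = A2 * U2"
  have T: "T1 \<in> carrier_mat m m" "T2 \<in> carrier_mat l l"
    using c U by (auto simp: T1_def T2_def)
  note AUD = AUD[folded T1_def T2_def] and bd = bd[folded T1_def T2_def]
  \<comment> \<open>The coupling block \<open>X * U2\<close> is reduced modulo the columns of \<open>T1\<close>, which leaves \<open>T1 * R\<close> with
    a small \<open>R\<close>; in the inverse the coupling block is then \<open>- (R * D2)\<close>.\<close>
  define Y W R where "Y = D1 * (X * U2)"
    and "W = mat m l (\<lambda>ij. - real_of_int (round (Y $$ ij)))"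
    and "R = W + Y"
  have YWR: "Y \<in> carrier_mat m l" "W \<in> carrier_mat m l" "R \<in> carrier_mat m l"
    using D c U by (auto simp: Y_def W_def R_def)
  have intW: "integral_mat W"
    by (auto simp: integral_mat_def W_def)
  \<comment> \<open>Up to sign, an entry of \<open>R\<close> is a rounding error, hence at most 1/2
    in absolute value; the bound 1 suffices.\<close>
  have "\<bar>R $$ (i, j)\<bar> \<le> 1" if "i < m" "j < l" for i j
  proof -
    have "R $$ (i, j) = - (of_int (round (Y $$ (i, j))) - Y $$ (i, j))"
      using YWR that by (simp add: R_def W_def)
    then show ?thesis
      using of_int_round_abs_le[of "Y $$ (i, j)"] by linarith
  qed
  then have bdR: "entries_bounded 1 R"
    using YWR by (auto simp: entries_bounded_def)
  have "T1 * Y = T1 * D1 * (X * U2)"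
    unfolding Y_def using T D c U by (intro assoc_mult_mat[symmetric]) auto
  then have T1Y: "T1 * Y = X * U2"
    using AUD c U by simp
  \<comment> \<open>Adding the integer combinations \<open>T1 * W\<close> of the columns of
    \<open>T1\<close> to \<open>X * U2 = T1 * Y\<close> leaves exactly
    \<open>T1 * R\<close>.\<close>
  have T1R: "T1 * R = A1 * (U1 * W) + X * U2"
    unfolding R_def using T YWR c U by (simp add: mult_add_distrib_mat T1Y) (simp add: T1_def)
  \<comment> \<open>The block \<open>U1 * W\<close> is chosen because \<open>A1\<close> maps it to
    \<open>T1 * W\<close>. Inverting a block triangular matrix gives the coupling block minus
    inverse times block times inverse; for \<open>U\<close> the factor \<open>U1\<close> cancels,
    which leaves \<open>- (W * V2)\<close>.\<close>
  define U V D where "U = four_block_mat U1 (U1 * W) (0\<^sub>m l m) U2"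
    and "V = four_block_mat V1 (- (W * V2)) (0\<^sub>m l m) V2"
    and "D = four_block_mat D1 (- (R * D2)) (0\<^sub>m l m) D2"
  have AU: "A * U = four_block_mat T1 (T1 * R) (0\<^sub>m l m) T2"
    unfolding A U_def T1R using c U YWR
    by (subst mult_block_upper_triangular) (auto simp: T1_def T2_def)
  have one: "four_block_mat (1\<^sub>m m) (0\<^sub>m m l) (0\<^sub>m l m) (1\<^sub>m l) = (1\<^sub>m n :: real mat)"
    using n by auto
  have "U * V = 1\<^sub>m n"
  proof -
    have "U * V = four_block_mat (U1 * V1) (U1 * (- (W * V2)) + U1 * W * V2) (0\<^sub>m l m) (U2 * V2)"
      unfolding U_def V_def using U V YWR by (intro mult_block_upper_triangular) auto
    also have "U1 * (- (W * V2)) + U1 * W * V2 = 0\<^sub>m m l"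
      using U V YWR by (simp add: uminus_l_inv_mat[of _ m l])
    finally show ?thesis
      by (simp only: UV one)
  qed
  moreover have "A * U * D = 1\<^sub>m n"
  proof -
    have "A * U * D = four_block_mat (T1 * D1) (T1 * (- (R * D2)) + T1 * R * D2) (0\<^sub>m l m) (T2 * D2)"
      unfolding AU D_def using T D YWR by (intro mult_block_upper_triangular) auto
    also have "T1 * (- (R * D2)) + T1 * R * D2 = 0\<^sub>m m l"
      using T D YWR by (simp add: uminus_l_inv_mat[of _ m l])
    finally show ?thesis
      by (simp only: AUD one)
  qed
  moreover have "D * (A * U) = 1\<^sub>m n"
  proof -
    have "D * (A * U) = four_block_mat (D1 * T1) (D1 * (T1 * R) + - (R * D2) * T2) (0\<^sub>m l m) (D2 * T2)"
      unfolding AU D_def using T D YWR by (intro mult_block_upper_triangular) auto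
    also have "D1 * (T1 * R) = D1 * T1 * R"
      using T D YWR by simp
    also have "- (R * D2) * T2 = - (R * (D2 * T2))"
      using T D YWR by simp
    also have "D1 * T1 * R + - (R * (D2 * T2)) = 0\<^sub>m m l"
      using YWR AUD by (simp add: add_uminus_minus_mat[of _ m l])
    finally show ?thesis
      by (simp only: AUD one)
  qed
  moreover have "integral_mat U" "integral_mat V"
  proof -
    have "integral_mat (U1 * W)" "integral_mat (- (W * V2))"
      using integral_mat_mult[OF U(1) YWR(2)] integral_mat_mult[OF YWR(2) V(2)]
        integral_mat_uminus[of "W * V2" m l] YWR V int intW by auto
    moreover have "integral_mat (0\<^sub>m l m)"
      by (simp add: integral_mat_def)
    ultimately show "integral_mat U" "integral_mat V"
      unfolding U_def V_def using U V YWR int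
      by (auto intro!: integral_mat_four_block[of _ m m _ l _ l])
  qed
  moreover have "entries_bounded (M ^ Suc k) (A * U)" "entries_bounded (M ^ Suc k) D"
  proof -
    \<comment> \<open>The factors \<open>m\<close> and \<open>l\<close> from the matrix products are
      at most \<open>M\<close>; this is the one factor \<open>M\<close> lost per halving.\<close>
    have le: "M ^ k \<le> M ^ Suc k" "real m * (M ^ k * 1) \<le> M ^ Suc k" "real l * (1 * M ^ k) \<le> M ^ Suc k"
      and nonneg: "0 \<le> M ^ k" "0 \<le> M ^ Suc k"
      using ml \<open>1 \<le> M\<close> by (auto intro: mult_right_mono power_increasing)
    have "entries_bounded (M ^ Suc k) (0\<^sub>m l m)"
      using nonneg by (simp add: entries_bounded_def)
    moreover have "entries_bounded (M ^ Suc k) (T1 * R)"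
      using entries_bounded_mult[OF T(1) bd(1) YWR(3) bdR nonneg(1)] le(2) by (rule entries_bounded_mono)
    moreover have "entries_bounded (M ^ Suc k) (- (R * D2))"
      using entries_bounded_mult[OF YWR(3) bdR D(2) bd(4)] le(3)
      by (intro entries_bounded_uminus) (auto intro: entries_bounded_mono)
    ultimately show "entries_bounded (M ^ Suc k) (A * U)" "entries_bounded (M ^ Suc k) D"
      unfolding AU D_def using T D YWR bd le(1)
      by (auto intro!: entries_bounded_four_block[of _ m m _ l _ l] intro: entries_bounded_mono)
  qed
  moreover have "U \<in> carrier_mat n n" "V \<in> carrier_mat n n" "D \<in> carrier_mat n n"
    unfolding U_def V_def D_def n using U V D by auto
  ultimately show ?case
    by blast
qed

section \<open>HKZ reducedness of unit upper triangular matrices\<close>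

text \<open>The definite description is unique: the difference of two candidates lies both in the
  span of \<open>S\<close> and in its orthogonal complement, so it is orthogonal to itself.\<close>

lemma proj_perp_eqI:
  assumes S: "S \<subseteq> carrier_vec n" and v: "v \<in> carrier_vec n" and w: "w \<in> carrier_vec n"
    and orth: "\<And>y. y \<in> S \<Longrightarrow> w \<bullet> y = 0" and span: "v - w \<in> vspan n S"
  shows "proj_perp n S v = w"
proof -
  interpret vec_space "TYPE(real)" n .
  show ?thesis
    unfolding proj_perp_def
  proof (rule the_equality)
    show "w \<in> orthogonal_complement S \<and> v - w \<in> local.span S"
      using assms by (auto simp: orthogonal_complement_def)
    fix w' assume w': "w' \<in> orthogonal_complement S \<and> v - w' \<in> local.span S"
    then have c: "w' \<in> carrier_vec n"
      by (auto simp: orthogonal_complement_def)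
    define d where "d = w - w'"
    have d: "d \<in> carrier_vec n"
      using w c by (simp add: d_def)
    have "(v - w') + (- 1) \<cdot>\<^sub>v (v - w) \<in> local.span S"
      using S w' span by (intro span_add1 smult_in_span) auto
    also have "(v - w') + (- 1) \<cdot>\<^sub>v (v - w) = d"
      using v w c by (intro eq_vecI) (auto simp: d_def)
    finally have "d \<in> local.span S" .
    moreover have "d \<in> orthogonal_complement S"
    proof -
      have "d \<bullet> y = 0" if "y \<in> S" for y
        using that S w c w' orth minus_scalar_prod_distrib[of w n w' y]
        by (auto simp: d_def orthogonal_complement_def)
      then show ?thesis
        using d by (auto simp: orthogonal_complement_def)
    qed
    ultimately have "d \<bullet> d = 0"
      using in_orthogonal_complement_span[OF S] by (auto simp: orthogonal_complement_def)
    then have "\<bar>d $ i\<bar> \<le> 0" if "i < n" for i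
      using abs_index_le_eucl_norm[of i d] d that by (simp add: eucl_norm_def)
    then show "w' = w"
      using w c by (intro eq_vecI) (auto simp: d_def)
  qed
qed

text \<open>Back substitution from the last row: subtracting \<open>v $ j\<close> times column
  \<open>j\<close> clears coordinate \<open>j\<close> and creates no entries outside the rows
  \<open>k..<j\<close>.\<close>

lemma in_span_cols_upper_triangular:
  fixes C :: "real mat"
  assumes C: "C \<in> carrier_mat n n" and diag: "\<And>i. k \<le> i \<Longrightarrow> i < j \<Longrightarrow> C $$ (i, i) = 1"
    and zero: "\<And>r i. k \<le> i \<Longrightarrow> i < j \<Longrightarrow> r < n \<Longrightarrow> r < k \<or> i < r \<Longrightarrow> C $$ (r, i) = 0"
    and j: "j \<le> n"
    and v: "v \<in> carrier_vec n" "\<And>r. r < n \<Longrightarrow> r < k \<or> j \<le> r \<Longrightarrow> v $ r = 0"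
  shows "v \<in> vspan n (col C ` {k..<j})"
  using diag zero j v
proof (induction j arbitrary: v)
  case 0
  interpret vec_space "TYPE(real)" n .
  have "v = 0\<^sub>v n"
    using 0 by (intro eq_vecI) auto
  then show ?case
    by (simp add: span_zero)
next
  case (Suc j)
  interpret vec_space "TYPE(real)" n .
  have sub: "col C ` {k..<Suc j} \<subseteq> carrier_vec n"
    using C by auto
  show ?case
  proof (cases "k \<le> j")
    case False
    then have "r < k \<or> Suc j \<le> r" for r
      by linarith
    then have "v = 0\<^sub>v n"
      using Suc.prems(4,5) by (intro eq_vecI) auto
    then show ?thesis
      by (simp add: span_zero)
  next
    case True
    define u where "u = v - v $ j \<cdot>\<^sub>v col C j"
    have col: "col C j \<in> carrier_vec n"
      using C by auto
    have "u \<in> local.span (col C ` {k..<j})"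
    proof (rule Suc.IH)
      show "u \<in> carrier_vec n"
        using Suc.prems col by (simp add: u_def)
      fix r assume "r < n" "r < k \<or> j \<le> r"
      then show "u $ r = 0"
        using Suc.prems C True by (cases "r = j") (auto simp: u_def)
    qed (use Suc.prems in auto)
    then have "u \<in> local.span (col C ` {k..<Suc j})"
      using span_is_monotone[OF image_mono, of "{k..<j}" "{k..<Suc j}" "col C"] by auto
    moreover have "col C j \<in> local.span (col C ` {k..<Suc j})"
      using in_own_span[OF sub] True by auto
    ultimately have "u + v $ j \<cdot>\<^sub>v col C j \<in> local.span (col C ` {k..<Suc j})"
      using sub by (intro span_add1 smult_in_span) auto
    also have "u + v $ j \<cdot>\<^sub>v col C j = v"
      using Suc.prems C by (intro eq_vecI) (auto simp: u_def)
    finally show ?thesis .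
  qed
qed

text \<open>The Gram-Schmidt vectors will turn out to be unit vectors, so every projection in the
  HKZ recursion merely erases one coordinate.\<close>

lemma proj_perp_unit_vec:
  assumes "k < n" "v \<in> carrier_vec n"
  shows "proj_perp n {unit_vec n k} v = vec n (\<lambda>r. if r = k then 0 else v $ r)"
proof (rule proj_perp_eqI)
  interpret vec_space "TYPE(real)" n .
  have "v - vec n (\<lambda>r. if r = k then 0 else v $ r) = v $ k \<cdot>\<^sub>v unit_vec n k"
    using assms by (intro eq_vecI) auto
  then show "v - vec n (\<lambda>r. if r = k then 0 else v $ r) \<in> vspan n {unit_vec n k}"
    using in_own_span[of "{unit_vec n k}"] by (auto intro!: smult_in_span)
qed (use assms in auto)

section \<open>Projected bases of a unit upper triangular matrix\<close>

lemma unit_upper_triangularD: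
  assumes "unit_upper_triangular A" "A \<in> carrier_mat n n"
  shows "i < n \<Longrightarrow> A $$ (i, i) = 1" "i < n \<Longrightarrow> j < i \<Longrightarrow> A $$ (i, j) = 0"
  using assms by (auto simp: unit_upper_triangular_def upper_triangular_def)

lemma det_unit_upper_triangular:
  assumes "A \<in> carrier_mat n n" "unit_upper_triangular A"
  shows "det A = 1"
  using assms det_upper_triangular[of A n]
  by (simp add: unit_upper_triangular_def prod_list_diag_prod)

text \<open>For unit upper triangular \<open>A\<close>, the columns \<open>k, k + 1, \<dots>\<close> of \<open>clear_rows k A\<close> are the
  projections of those of \<open>A\<close> onto the orthogonal complement of the first \<open>k\<close> columns.\<close>

definition clear_rows :: "nat \<Rightarrow> 'a :: {zero, one} mat \<Rightarrow> 'a mat" where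
  "clear_rows k A = mat (dim_row A) (dim_col A)
     (\<lambda>(r, i). if r < k then if r = i then 1 else 0 else A $$ (r, i))"

lemma clear_rows_carrier: "A \<in> carrier_mat n m \<Longrightarrow> clear_rows k A \<in> carrier_mat n m"
  by (auto simp: clear_rows_def)

lemma clear_rows_0: "clear_rows 0 A = A"
  by (auto simp: clear_rows_def)

text \<open>Filling the cleared rows with identity rows instead of zeros keeps the determinant at 1,
  from which independence of the projected columns follows.\<close>

lemma unit_upper_triangular_clear_rows:
  assumes "unit_upper_triangular A" "A \<in> carrier_mat n n"
  shows "unit_upper_triangular (clear_rows k A)"
  using assms by (auto simp: unit_upper_triangular_def upper_triangular_def clear_rows_def)

text \<open>The basis reached after \<open>k\<close> steps of the HKZ recursion: in the columns from
  \<open>k\<close> on, all entries in rows below index \<open>k\<close> are 0.\<close>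

definition proj_basis :: "nat \<Rightarrow> real mat \<Rightarrow> real vec list" where
  "proj_basis k A = map (col (clear_rows k A)) [k..<dim_col A]"

context
  fixes A :: "real mat" and n :: nat
  assumes A: "A \<in> carrier_mat n n" and uut: "unit_upper_triangular A"
    and half: "\<And>i j. i < j \<Longrightarrow> j < n \<Longrightarrow> \<bar>A $$ (i, j)\<bar> \<le> 1 / 2"
begin

lemma col_clear_rows:
  "i < n \<Longrightarrow> col (clear_rows k A) i = vec n (\<lambda>r. if r < k then if r = i then 1 else 0 else A $$ (r, i))"
  using A by (auto simp: clear_rows_def)

lemma proj_basis_carrier: "set (proj_basis k A) \<subseteq> carrier_vec n"
  using A clear_rows_carrier[OF A, of k] by (auto simp: proj_basis_def)

text \<open>Coefficients are indexed by the columns \<open>k..<n\<close> instead of list positions,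
  so that passing from \<open>k\<close> to \<open>Suc k\<close> drops one summand and one
  coordinate.\<close>

lemma lattice_of_proj_basis:
  "vec_module.lattice_of n (proj_basis k A) =
    range (\<lambda>c. vec n (\<lambda>r. if r < k then 0 else \<Sum>j = k..<n. real_of_int (c j) * A $$ (r, j)))"
    (is "_ = range ?f")
proof -
  have "vec_module.lattice_of n (proj_basis k A) = range (\<lambda>c. ?f (\<lambda>j. c (j - k)))"
    unfolding lattice_of_eq[OF proj_basis_carrier]
  proof (intro image_cong refl eq_vecI)
    fix c :: "nat \<Rightarrow> int" and r assume "r < dim_vec (?f (\<lambda>j. c (j - k)))"
    then have r: "r < n" by simp
    have "(\<Sum>i<length (proj_basis k A). real_of_int (c i) * proj_basis k A ! i $ r) =
      (\<Sum>j = k..<n. real_of_int (c (j - k)) * col (clear_rows k A) j $ r)"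
      using A by (intro sum.reindex_bij_witness[of _ "\<lambda>j. j - k" "\<lambda>i. i + k"])
        (auto simp: proj_basis_def add.commute)
    then show "vec n (\<lambda>r. \<Sum>i<length (proj_basis k A). real_of_int (c i) * proj_basis k A ! i $ r) $ r
      = ?f (\<lambda>j. c (j - k)) $ r"
      using r by (auto simp: col_clear_rows)
  qed auto
  also have "\<dots> = range ?f"
  proof (intro equalityI subsetI)
    fix x assume "x \<in> range ?f"
    then obtain c where "x = ?f c" by auto
    then have "x = ?f (\<lambda>j. (\<lambda>i. c (i + k)) (j - k))"
      by (auto intro!: eq_vecI sum.cong)
    then show "x \<in> range (\<lambda>c. ?f (\<lambda>j. c (j - k)))"
      by (rule range_eqI[where x = "\<lambda>i. c (i + k)"])
  qed auto
  finally show ?thesis .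
qed

text \<open>The vectors are among the columns of a matrix of nonzero determinant, which are
  independent and pairwise distinct.\<close>

lemma lattice_basis_proj_basis:
  "lattice_basis n (proj_basis k A) (vec_module.lattice_of n (proj_basis k A))"
proof -
  interpret vec_space "TYPE(real)" n .
  note C = clear_rows_carrier[OF A, of k]
  have det: "det (clear_rows k A) \<noteq> 0"
    using det_unit_upper_triangular[OF C unit_upper_triangular_clear_rows[OF uut A]] by simp
  then have "\<not> lin_dep (set (cols (clear_rows k A)))"
    using lin_dep_cols_imp_det_0[OF C] by blast
  moreover have "set (proj_basis k A) \<subseteq> set (cols (clear_rows k A))"
    using A C by (auto simp: proj_basis_def cols_def)
  ultimately have "\<not> lin_dep (set (proj_basis k A))"
    using subset_li_is_li by blast
  moreover have "inj_on (col (clear_rows k A)) {k..<n}"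
    using det det_identical_columns[OF C] by (force simp: inj_on_def)
  then have "distinct (proj_basis k A)"
    using A by (simp add: proj_basis_def distinct_map)
  ultimately show ?thesis
    using proj_basis_carrier by (simp add: lattice_basis_def)
qed

text \<open>The value 1 is attained at \<open>unit_vec n k\<close>; every nonzero lattice vector has
  a nonzero integer coordinate and hence length at least 1.\<close>

lemma min_length_proj_basis:
  assumes k: "k < n"
  shows "min_length n (vec_module.lattice_of n (proj_basis k A)) = 1"
  unfolding min_length_def
proof (rule cInf_eq_minimum)
  have "unit_vec n k = vec n (\<lambda>r. if r < k then 0 else
      \<Sum>j = k..<n. real_of_int ((\<lambda>j. if j = k then 1 else 0) j) * A $$ (r, j))"
    using k unit_upper_triangularD[OF uut A]
    by (intro eq_vecI) (auto simp: if_distrib[of real_of_int] if_distrib[of "\<lambda>x. x * _"] cong: if_cong)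
  then have "unit_vec n k \<in> vec_module.lattice_of n (proj_basis k A)"
    unfolding lattice_of_proj_basis by (rule range_eqI[where x = "\<lambda>j. if j = k then 1 else 0"])
  moreover have "unit_vec n k \<noteq> 0\<^sub>v n"
    using k by simp
  ultimately show "1 \<in> eucl_norm ` (vec_module.lattice_of n (proj_basis k A) - {0\<^sub>v n})"
    using eucl_norm_unit_vec[OF k] by (metis DiffI image_eqI singletonD)
next
  fix x assume "x \<in> eucl_norm ` (vec_module.lattice_of n (proj_basis k A) - {0\<^sub>v n})"
  then obtain c where "x \<in> eucl_norm ` ({vec n (\<lambda>r. if r < k then 0 else
      \<Sum>j = k..<n. real_of_int (c j) * A $$ (r, j))} - {0\<^sub>v n})" (is "x \<in> eucl_norm ` ({?v} - _)")
    unfolding lattice_of_proj_basis by auto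
  then have x: "x = eucl_norm ?v" and nz: "?v \<noteq> 0\<^sub>v n"
    by auto
  define J where "J = {j \<in> {k..<n}. c j \<noteq> 0}"
  have "J \<noteq> {}"
  proof
    assume "J = {}"
    then have "?v = 0\<^sub>v n"
      by (intro eq_vecI) (auto simp: J_def)
    with nz show False by simp
  qed
  moreover have fin: "finite J"
    by (simp add: J_def)
  ultimately have m: "Max J \<in> J" by simp
  \<comment> \<open>The last nonzero coefficient is the corresponding coordinate, since the diagonal is 1.\<close>
  have "(\<Sum>j = k..<n. real_of_int (c j) * A $$ (Max J, j))
    = (\<Sum>j = k..<n. if j = Max J then real_of_int (c j) else 0)"
  proof (intro sum.cong refl)
    fix j assume j: "j \<in> {k..<n}"
    then have "c j = 0" if "j \<notin> J"
      using that by (simp add: J_def)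
    then consider "j < Max J" | "j = Max J" | "c j = 0" "j \<noteq> Max J"
      using Max_ge[OF fin, of j] by linarith
    then show "real_of_int (c j) * A $$ (Max J, j) = (if j = Max J then real_of_int (c j) else 0)"
      using m unit_upper_triangularD[OF uut A] by cases (auto simp: J_def)
  qed
  then have "?v $ Max J = real_of_int (c (Max J))"
    using m by (auto simp: J_def)
  moreover have "1 \<le> \<bar>real_of_int (c (Max J))\<bar>"
    using m by (auto simp: J_def)
  ultimately show "1 \<le> x"
    using abs_index_le_eucl_norm[of "Max J" ?v] m x by (auto simp: J_def)
qed

text \<open>Column \<open>k + i\<close> minus its diagonal unit vector lives in the rows
  \<open>k..<k + i\<close>, hence in the span of the preceding columns; these vanish in row
  \<open>k + i\<close>, so they are orthogonal to the unit vector.\<close>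

lemma gs_vec_proj_basis:
  assumes i: "k + i < n"
  shows "gs_vec n (proj_basis k A) i = unit_vec n (k + i)"
proof -
  note C = clear_rows_carrier[OF A, of k]
  have nth: "proj_basis k A ! i = col (clear_rows k A) (k + i)"
    using i A by (simp add: proj_basis_def)
  have set: "set (take i (proj_basis k A)) = col (clear_rows k A) ` {k..<k + i}"
    using i A by (simp add: proj_basis_def take_map)
  show ?thesis
    unfolding gs_vec_def nth set
  proof (rule proj_perp_eqI)
    show "col (clear_rows k A) (k + i) - unit_vec n (k + i)
      \<in> vspan n (col (clear_rows k A) ` {k..<k + i})"
      using i A C unit_upper_triangularD[OF uut A]
      by (intro in_span_cols_upper_triangular) (auto simp: clear_rows_def)
  next
    fix y assume "y \<in> col (clear_rows k A) ` {k..<k + i}"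
    then obtain j where "k \<le> j" "j < k + i" "y = col (clear_rows k A) j" by auto
    then show "unit_vec n (k + i) \<bullet> y = 0"
      using i A unit_upper_triangularD[OF uut A] by (simp add: col_clear_rows)
  qed (use i C in auto)
qed

text \<open>A product with a unit vector reads off an entry, with row and column in reversed order.
  Size reduction thus becomes the bound 1/2 on the entries above the diagonal.\<close>

lemma gs_coeff_proj_basis:
  assumes "k + i < n" "j < i"
  shows "gs_coeff n (proj_basis k A) i j = A $$ (k + j, k + i)"
proof -
  have "proj_basis k A ! i = col (clear_rows k A) (k + i)"
    using assms A by (simp add: proj_basis_def)
  then show ?thesis
    using assms A by (simp add: gs_coeff_def gs_vec_proj_basis col_clear_rows)
qed

lemma proj_basis_Cons:
  assumes "k < n"
  shows "proj_basis k A = unit_vec n k # map (col (clear_rows k A)) [Suc k..<n]"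
proof -
  have "col (clear_rows k A) k = unit_vec n k"
    using assms unit_upper_triangularD[OF uut A] by (auto simp: col_clear_rows intro!: eq_vecI)
  then show ?thesis
    using assms A by (simp add: proj_basis_def upt_conv_Cons)
qed

lemma proj_perp_proj_basis:
  assumes "k < n"
  shows "map (proj_perp n {unit_vec n k}) (map (col (clear_rows k A)) [Suc k..<n]) = proj_basis (Suc k) A"
  using assms A by (auto simp: proj_basis_def col_clear_rows proj_perp_unit_vec intro!: eq_vecI)

text \<open>Column \<open>k\<close> vanishes below row \<open>k\<close>, and the projection erases
  coordinate \<open>k\<close>, so the coefficient of that column disappears.\<close>

lemma proj_perp_lattice_of_proj_basis:
  assumes k: "k < n"
  shows "proj_perp n {unit_vec n k} ` vec_module.lattice_of n (proj_basis k A)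
    = vec_module.lattice_of n (proj_basis (Suc k) A)"
  unfolding lattice_of_proj_basis image_image
proof (intro image_cong refl)
  fix c :: "nat \<Rightarrow> int"
  have "(\<Sum>j = k..<n. real_of_int (c j) * A $$ (r, j)) = (\<Sum>j = Suc k..<n. real_of_int (c j) * A $$ (r, j))"
    if "k < r" "r < n" for r
    using that k unit_upper_triangularD[OF uut A] by (simp add: sum.atLeast_Suc_lessThan)
  then show "proj_perp n {unit_vec n k}
      (vec n (\<lambda>r. if r < k then 0 else \<Sum>j = k..<n. real_of_int (c j) * A $$ (r, j)))
    = vec n (\<lambda>r. if r < Suc k then 0 else \<Sum>j = Suc k..<n. real_of_int (c j) * A $$ (r, j))"
    using k by (subst proj_perp_unit_vec) (auto intro!: eq_vecI)
qed

lemma hkz_reduced_proj_basis: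
  assumes "k < n"
  shows "hkz_reduced n (proj_basis k A) (vec_module.lattice_of n (proj_basis k A))"
  using assms
proof (induction "n - k" arbitrary: k)
  case (Suc d)
  have len: "length (proj_basis k A) = n - k"
    using A by (simp add: proj_basis_def)
  have "\<bar>gs_coeff n (proj_basis k A) i j\<bar> \<le> 1 / 2" if "i < length (proj_basis k A)" "j < i" for i j
    using that len half[of "k + j" "k + i"] by (simp add: gs_coeff_proj_basis)
  \<comment> \<open>A nonempty tail means \<open>Suc k < n\<close>, which is what the induction
    hypothesis requires.\<close>
  moreover have "hkz_reduced n (proj_basis (Suc k) A) (vec_module.lattice_of n (proj_basis (Suc k) A))"
    if "map (col (clear_rows k A)) [Suc k..<n] \<noteq> []"
    using that Suc by simp
  ultimately show ?case
    using lattice_basis_proj_basis[of k] min_length_proj_basis[OF Suc.prems]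
      proj_perp_lattice_of_proj_basis[OF Suc.prems] proj_perp_proj_basis[OF Suc.prems]
      eucl_norm_unit_vec[OF Suc.prems]
    unfolding proj_basis_Cons[OF Suc.prems] hkz_reduced.simps by presburger
qed simp

end

lemma unit_upper_triangular_imp_hkz_reduced:
  assumes "A \<in> carrier_mat n n" "unit_upper_triangular A"
    and "\<And>i j. i < j \<Longrightarrow> j < n \<Longrightarrow> \<bar>A $$ (i, j)\<bar> \<le> 1 / 2" and "0 < n"
  shows "hkz_reduced n (cols A) (lattice_gen A)"
proof -
  have "proj_basis 0 A = cols A"
    by (simp add: proj_basis_def clear_rows_0 cols_def)
  then show ?thesis
    using hkz_reduced_proj_basis[OF assms(1-3), of 0] assms by (simp add: lattice_gen_def)
qed

section \<open>An ill-conditioned HKZ-reduced basis\<close>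

text \<open>The map is the reduced basis \<open>T = A * U\<close>. It and its inverse
  \<open>D\<close> have norm at most \<open>n * (n * n^k)\<close> each, and the product of the two
  bounds gives the exponent \<open>2 * k + 4\<close>.\<close>

lemma lattice_dist_unit_upper_triangular_le:
  assumes A: "A \<in> carrier_mat n n" and uut: "unit_upper_triangular A" and n: "0 < n" and k: "n \<le> 2 ^ k"
  shows "lattice_dist n (int_lattice n) (lattice_gen A) \<le> real n ^ (2 * k + 4)"
proof -
  have n1: "1 \<le> real n"
    using n by simp
  obtain U V D where U: "U \<in> carrier_mat n n" "integral_mat U" and V: "V \<in> carrier_mat n n" "integral_mat V"
    and UV: "U * V = 1\<^sub>m n"
    and D: "D \<in> carrier_mat n n" and inv: "A * U * D = 1\<^sub>m n" "D * (A * U) = 1\<^sub>m n"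
    and bd: "entries_bounded (real n ^ k) (A * U)" "entries_bounded (real n ^ k) D"
    using seysen_reduction[OF A uut k order_refl n1] by blast
  define T where "T = A * U"
  have T: "T \<in> carrier_mat n n"
    using A U by (simp add: T_def)
  have "(\<lambda>x. T *\<^sub>v x) ` int_lattice n = (\<lambda>x. A *\<^sub>v x) ` (\<lambda>x. U *\<^sub>v x) ` int_lattice n"
    unfolding image_image T_def using A U
    by (intro image_cong refl assoc_mult_mat_vec) (auto simp: int_lattice_def)
  then have "(\<lambda>x. T *\<^sub>v x) ` int_lattice n = lattice_gen A"
    by (simp add: lattice_gen_eq_image[OF A] image_int_lattice_unimodular[OF U V UV])
  then have "lattice_dist n (int_lattice n) (lattice_gen A) \<le> cond_number T"
    using lattice_dist_le_cond_number[OF n T D] inv unfolding T_def by blast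
  also have "cond_number T = op_norm T * op_norm D"
    using mat_inverse_eq[OF T D] inv by (simp add: cond_number_def T_def)
  also have "\<dots> \<le> (real n * (real n * real n ^ k)) * (real n * (real n * real n ^ k))"
    using bd n T D op_norm_nonneg[of D n n]
    by (intro mult_mono op_norm_le) (auto intro: entries_boundedD simp: T_def)
  also have "\<dots> = real n ^ (2 * k + 4)"
    by (simp add: power_add power_even_eq power2_eq_square power4_eq_xxxx)
  finally show ?thesis .
qed

section \<open>The extremal matrix and the growth of its inverse\<close>

text \<open>The entries above the diagonal have the largest size that size reduction allows; being
  all negative, they make back substitution accumulate without cancellation.\<close>

definition hkz_mat :: "nat \<Rightarrow> real mat" where
  "hkz_mat n = mat n n (\<lambda>(i, j). if i = j then 1 else if i < j then - 1 / 2 else 0)"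

lemma hkz_mat_carrier: "hkz_mat n \<in> carrier_mat n n"
  by (simp add: hkz_mat_def)

lemma unit_upper_triangular_hkz_mat: "unit_upper_triangular (hkz_mat n)"
  by (auto simp: hkz_mat_def unit_upper_triangular_def)

text \<open>Twice the last column of the inverse of \<open>hkz_mat n\<close>, found by back
  substitution: the last entry is 2 and each earlier one is half the sum of those after it.\<close>

definition expanding_vec :: "nat \<Rightarrow> real vec" where
  "expanding_vec n = vec n (\<lambda>i. if i = n - 1 then 2 else (3 / 2) ^ (n - 2 - i))"

text \<open>Each entry is half the tail after it, so every step downwards multiplies the tail sum by
  3/2, starting from the last entry 2.\<close>

lemma sum_expanding_vec:
  assumes "i < n"
  shows "(\<Sum>j = i..<n. expanding_vec n $ j) = 2 * (3 / 2) ^ (n - 1 - i)"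
proof -
  have "i \<le> n - 1" using assms by simp
  then show ?thesis
  proof (induction rule: inc_induct)
    case base
    then show ?case
      using assms by (cases n) (auto simp: expanding_vec_def)
  next
    case (step m)
    have "(\<Sum>j = m..<n. expanding_vec n $ j)
      = (3 / 2) ^ (n - 1 - Suc m) + 2 * (3 / 2) ^ (n - 1 - Suc m)"
      using step by (simp add: sum.atLeast_Suc_lessThan) (simp add: expanding_vec_def numeral_2_eq_2)
    also have "\<dots> = 2 * (3 / 2) ^ Suc (n - 1 - Suc m)"
      by simp
    also have "Suc (n - 1 - Suc m) = n - 1 - m"
      using step by simp
    finally show ?case .
  qed
qed

text \<open>Row \<open>i\<close> yields entry \<open>i\<close> minus half the tail after it, which
  vanishes except in the last row.\<close>

lemma hkz_mat_mult_expanding_vec: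
  assumes "0 < n"
  shows "hkz_mat n *\<^sub>v expanding_vec n = 2 \<cdot>\<^sub>v unit_vec n (n - 1)"
proof (rule eq_vecI)
  fix i assume "i < dim_vec (2 \<cdot>\<^sub>v unit_vec n (n - 1) :: real vec)"
  then have i: "i < n" by simp
  have "(hkz_mat n *\<^sub>v expanding_vec n) $ i
    = (\<Sum>j = 0..<n. (if i = j then 1 else if i < j then - 1 / 2 else 0) * expanding_vec n $ j)"
    using i by (simp add: hkz_mat_def scalar_prod_def expanding_vec_def)
  also have "\<dots> = (\<Sum>j = i..<n. (if i = j then 1 else if i < j then - 1 / 2 else 0) * expanding_vec n $ j)"
    by (intro sum.mono_neutral_right) auto
  also have "\<dots> = expanding_vec n $ i - (\<Sum>j = Suc i..<n. expanding_vec n $ j) / 2"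
    using i by (simp add: sum.atLeast_Suc_lessThan sum_divide_distrib flip: sum_negf)
  also have "\<dots> = (2 \<cdot>\<^sub>v unit_vec n (n - 1)) $ i"
  proof (cases "Suc i = n")
    case True
    then show ?thesis
      by (auto simp: expanding_vec_def)
  next
    case False
    then show ?thesis
      using i sum_expanding_vec[of "Suc i" n] by (simp add: expanding_vec_def numeral_2_eq_2)
  qed
  finally show "(hkz_mat n *\<^sub>v expanding_vec n) $ i = (2 \<cdot>\<^sub>v unit_vec n (n - 1)) $ i" .
qed (simp add: hkz_mat_def)

text \<open>The inverse sends the last unit vector to half of \<open>expanding_vec n\<close>, so its
  norm is at least half the first entry of that vector. The matrix itself has norm at least 1
  because it fixes the first unit vector.\<close>

lemma cond_number_hkz_mat_ge:
  assumes n: "0 < n"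
  shows "cond_number (hkz_mat n) \<ge> 2 / 9 * (3 / 2) ^ n"
proof -
  note B = hkz_mat_carrier[of n]
  have "det (hkz_mat n) \<noteq> 0"
    using det_unit_upper_triangular[OF B unit_upper_triangular_hkz_mat] by simp
  then obtain D where D: "D \<in> carrier_mat n n" and inv: "hkz_mat n * D = 1\<^sub>m n" "D * hkz_mat n = 1\<^sub>m n"
    using det_non_zero_imp_unit[OF B, of "()"] by (auto simp: Units_def ring_mat_def)
  have x: "expanding_vec n \<in> carrier_vec n"
    by (simp add: expanding_vec_def)
  have "expanding_vec n = D *\<^sub>v (hkz_mat n *\<^sub>v expanding_vec n)"
    using B D x inv by (simp flip: assoc_mult_mat_vec)
  also have "\<dots> = 2 \<cdot>\<^sub>v (D *\<^sub>v unit_vec n (n - 1))"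
    using D by (simp add: hkz_mat_mult_expanding_vec[OF n] mult_mat_vec)
  finally have "eucl_norm (expanding_vec n) = 2 * eucl_norm (D *\<^sub>v unit_vec n (n - 1))"
    by (simp add: eucl_norm_smult)
  also have "\<dots> \<le> 2 * op_norm D"
    using n by (intro mult_left_mono eucl_norm_le_op_norm[OF D] eucl_norm_unit_vec) auto
  finally have "\<bar>expanding_vec n $ 0\<bar> \<le> 2 * op_norm D"
    using abs_index_le_eucl_norm[of 0 "expanding_vec n"] n x by simp
  \<comment> \<open>For \<open>n \<ge> 2\<close> this is an equality, since the entry is
    \<open>(3 / 2) ^ (n - 2)\<close>; for \<open>n = 1\<close> the entry is 2.\<close>
  moreover have "4 / 9 * (3 / 2) ^ n \<le> \<bar>expanding_vec n $ 0\<bar>"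
  proof (cases "n = 1")
    case False
    then obtain m where "n = Suc (Suc m)"
      using n by (metis One_nat_def not0_implies_Suc not_gr_zero)
    then show ?thesis
      by (simp add: expanding_vec_def)
  qed (simp add: expanding_vec_def)
  ultimately have "2 / 9 * (3 / 2) ^ n \<le> op_norm D"
    by simp
  moreover have "1 \<le> op_norm (hkz_mat n)"
  proof -
    have "hkz_mat n *\<^sub>v unit_vec n 0 = unit_vec n 0"
      using n by (auto simp: hkz_mat_def)
    then show ?thesis
      using eucl_norm_le_op_norm[OF B, of "unit_vec n 0"] eucl_norm_unit_vec[OF n] by simp
  qed
  ultimately have "1 * (2 / 9 * (3 / 2) ^ n) \<le> op_norm (hkz_mat n) * op_norm D"
    by (intro mult_mono) auto
  then show ?thesis
    using mat_inverse_eq[OF B D inv] by (simp add: cond_number_def)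
qed

text \<open>Take \<open>k\<close> to be the ceiling of \<open>log 2 n\<close>. For
  \<open>n \<ge> 2\<close> the logarithm is at least 1, so \<open>2 * k + 4\<close> is at most
  \<open>2 * log 2 n + 6\<close>, hence at most \<open>8 * log 2 n\<close>. For \<open>n = 1\<close>
  both powers are 1 with \<open>k = 0\<close>.\<close>

lemma exists_quasipolynomial_exponent:
  assumes n: "1 \<le> n"
  shows "\<exists>k. n \<le> 2 ^ k \<and> real n ^ (2 * k + 4) \<le> real n powr (8 / ln 2 * ln (real n))"
proof (cases "n = 1")
  case False
  then have n2: "2 \<le> real n"
    using n by simp
  define k where "k = nat \<lceil>log 2 (real n)\<rceil>"
  have log1: "1 \<le> log 2 (real n)"
    using n2 by simp
  have "real n = 2 powr (log 2 (real n))"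
    using n2 by simp
  also have "\<dots> \<le> 2 powr real k"
    by (intro powr_mono) (auto simp: k_def real_nat_ceiling_ge)
  finally have "real n \<le> real (2 ^ k)"
    by (simp add: powr_realpow)
  then have nk: "n \<le> 2 ^ k"
    using of_nat_le_iff by blast
  have "real k \<le> log 2 (real n) + 1"
    using log1 unfolding k_def by linarith
  then have "real (2 * k + 4) \<le> 8 * log 2 (real n)"
    using log1 by simp
  also have "\<dots> = 8 / ln 2 * ln (real n)"
    by (simp add: log_def)
  finally have "real n powr real (2 * k + 4) \<le> real n powr (8 / ln 2 * ln (real n))"
    using n2 by (intro powr_mono) auto
  moreover have "real n powr real (2 * k + 4) = real n ^ (2 * k + 4)"
    using n2 by (intro powr_realpow) simp
  ultimately show ?thesis
    using nk by metis
qed (auto intro: exI[of _ 0])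

theorem theorem5p3:
  shows "\<exists>C c :: real. C > 0 \<and> c > 0 \<and>
    (\<forall>n \<ge> (1::nat). \<exists>B \<in> carrier_mat n n.
       hkz_reduced n (cols B) (lattice_gen B) \<and>
       lattice_dist n (int_lattice n) (lattice_gen B) \<le> real n powr (C * ln (real n)) \<and>
       cond_number B \<ge> c * (3 / 2) ^ n)"
proof (rule exI[of _ "8 / ln 2"], rule exI[of _ "2 / 9"], intro conjI allI impI)
  fix n :: nat assume n: "1 \<le> n"
  show "\<exists>B \<in> carrier_mat n n. hkz_reduced n (cols B) (lattice_gen B) \<and>
       lattice_dist n (int_lattice n) (lattice_gen B) \<le> real n powr (8 / ln 2 * ln (real n)) \<and>
       cond_number B \<ge> 2 / 9 * (3 / 2) ^ n"
  proof (intro bexI[OF _ hkz_mat_carrier] conjI)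
    show "hkz_reduced n (cols (hkz_mat n)) (lattice_gen (hkz_mat n))"
      using n by (intro unit_upper_triangular_imp_hkz_reduced[OF hkz_mat_carrier unit_upper_triangular_hkz_mat])
        (auto simp: hkz_mat_def)
    obtain k where "n \<le> 2 ^ k" "real n ^ (2 * k + 4) \<le> real n powr (8 / ln 2 * ln (real n))"
      using exists_quasipolynomial_exponent[OF n] by blast
    then show "lattice_dist n (int_lattice n) (lattice_gen (hkz_mat n)) \<le> real n powr (8 / ln 2 * ln (real n))"
      using lattice_dist_unit_upper_triangular_le[OF hkz_mat_carrier unit_upper_triangular_hkz_mat, of n k] n
      by linarith
    show "2 / 9 * (3 / 2) ^ n \<le> cond_number (hkz_mat n)"
      using cond_number_hkz_mat_ge n by simp
  qed
qed auto

end
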